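(* Let $q$ be a prime power and $v,k$ integers with $k\ge 2$. A $2$-$(v,k,1)_q$ design exists only if $v\equiv 1$ or $v\equiv k \pmod{k(k-1)}$.
   Context: A $2$-$(v,k,1)_q$ design (Steiner $2$-design over $\mathbb{F}_q$) is a collection $\mathcal{S}$ of $k$-dimensional subspaces of the vector space $\mathbb{F}_q^v$ such that every $2$-dimensional subspace of $\mathbb{F}_q^v$ is contained in exactly one member of $\mathcal{S}$. *)

theory Defs
  imports "HOL-Analysis.Analysis" "HOL-Number_Theory.Number_Theory"
begin

text \<open>
  The ambient space \<open>\<F>\<^sub>q\<^sup>v\<close> is the type \<open>'a ^ 'n\<close> of vectors indexed by a finite type \<open>'n\<close>
  over a finite field \<open>'a\<close>; the parameters \<open>q\<close> and \<open>v\<close> are pinned to \<open>CARD('a)\<close> and \<open>CARD('n)\<close>.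
  As types are nonempty, \<open>v \<ge> 1\<close>. (For \<open>v = 0\<close> the empty collection would vacuously be a design.)
\<close>

definition steiner_2_design ::
  "nat \<Rightarrow> nat \<Rightarrow> nat \<Rightarrow> ('a :: {field, finite} ^ 'n :: finite) set set \<Rightarrow> bool" where
  "steiner_2_design q v k S \<longleftrightarrow>
     CARD('a) = q \<and> CARD('n) = v \<and>
     (\<forall>B\<in>S. vec.subspace B \<and> vec.dim B = k) \<and>
     (\<forall>T. vec.subspace T \<and> vec.dim T = 2 \<longrightarrow> (\<exists>!B. B \<in> S \<and> T \<subseteq> B))"

end

theory Submission
  imports Defs
begin

text \<open>
  Counting the vectors outside the line spanned by \<open>x \<noteq> 0\<close> shows that \<open>q ^ (k - 1) - 1\<close> divides
  \<open>q ^ (v - 1) - 1\<close>, hence \<open>k - 1\<close> divides \<open>v - 1\<close>. Counting incident pairs of nonzero vectors and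
  blocks shows that \<open>q ^ k - 1\<close> divides \<open>(q ^ v - 1) * (q ^ (v - 1) - 1)\<close>, hence also
  \<open>(q ^ g - 1) * (q ^ h - 1)\<close> where \<open>g = gcd k v\<close> and \<open>h = gcd k (v - 1)\<close>. If \<open>k\<close> divided neither
  \<open>v\<close> nor \<open>v - 1\<close>, then \<open>g\<close> and \<open>h\<close> would be coprime proper divisors of \<open>k > 2\<close>, so
  \<open>g + h < k\<close> and this product would be too small.
\<close>

section \<open>Divisibility among the numbers \<open>q ^ n - 1\<close>\<close>

lemma gcd_power_minus_one_nat:
  fixes q m n :: nat
  assumes "q > 0"
  shows "gcd (q ^ m - 1) (q ^ n - 1) = q ^ gcd m n - 1"
proof (induction "m + n" arbitrary: m n rule: less_induct)
  case less
  have step: "gcd (q ^ a - 1) (q ^ b - 1) = q ^ gcd a b - 1"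
    if "a \<le> b" "a > 0" "a + b = m + n" for a b
  proof -
    \<comment> \<open>Euclid's algorithm on exponents: modulo \<open>q ^ a - 1\<close>, the number
      \<open>q ^ b - 1\<close> agrees with \<open>q ^ (b - a) - 1\<close>, so \<open>a\<close> may
      be subtracted from \<open>b\<close> without changing either gcd.\<close>
    have "q ^ b - 1 = (q ^ (b - a) - 1) + q ^ (b - a) * (q ^ a - 1)"
    proof -
      have "q ^ b = q ^ (b - a) * q ^ a" "q ^ (b - a) \<le> q ^ (b - a) * q ^ a" "1 \<le> q ^ (b - a)"
        using assms that(1) by (simp_all add: power_increasing Suc_le_eq flip: power_add)
      then show ?thesis
        by (simp add: diff_mult_distrib2)
    qed
    then have "gcd (q ^ a - 1) (q ^ b - 1) = gcd (q ^ a - 1) (q ^ (b - a) - 1)"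
      by (metis add.commute gcd_add_mult mult.commute)
    also have "\<dots> = q ^ gcd a (b - a) - 1"
      using less that by simp
    also have "gcd a (b - a) = gcd a b"
      using that by (metis gcd.commute gcd_diff1_nat)
    finally show ?thesis .
  qed
  show ?case
  proof (cases "m = 0 \<or> n = 0")
    case False
    then show ?thesis
      using step[of m n] step[of n m] by (cases "m \<le> n") (auto simp: gcd.commute)
  qed auto
qed

lemma dvd_of_power_minus_one_dvd:
  fixes q m n :: nat
  assumes "q > 1" and "q ^ m - 1 dvd q ^ n - 1"
  shows "m dvd n"
proof -
  have "q ^ gcd m n - 1 = q ^ m - 1"
    using assms gcd_power_minus_one_nat[of q m n] by (simp add: gcd_nat.absorb1)
  then have "q ^ gcd m n = q ^ m"
    using assms(1) by (metis One_nat_def eq_diff_iff one_le_power less_imp_le)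
  then have "gcd m n = m"
    using assms(1) by (simp add: power_inject_exp)
  then show ?thesis
    by (metis gcd_dvd2)
qed

lemma power_minus_one_dvd_prod_imp:
  fixes q k v :: nat
  assumes q: "q > 1" and k: "k \<ge> 2" and v: "v \<ge> 1"
    and dvd: "q ^ k - 1 dvd (q ^ v - 1) * (q ^ (v - 1) - 1)"
  shows "k dvd v \<or> k dvd v - 1"
proof (rule ccontr)
  assume neg: "\<not> (k dvd v \<or> k dvd v - 1)"
  define g h where "g = gcd k v" and "h = gcd k (v - 1)"
  \<comment> \<open>One of the consecutive numbers \<open>v - 1\<close> and \<open>v\<close> is
    even.\<close>
  have "k \<noteq> 2"
    using neg v by auto
  \<comment> \<open>A divisor of a product splits along its factors; \<open>b\<close> then divides
    \<open>gcd (q ^ k - 1) (q ^ v - 1)\<close>, which is \<open>q ^ g - 1\<close>, and likewise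
    \<open>c\<close> divides \<open>q ^ h - 1\<close>.\<close>
  obtain b c where bc: "q ^ k - 1 = b * c" "b dvd q ^ v - 1" "c dvd q ^ (v - 1) - 1"
    using division_decomp[OF dvd] by blast
  have "b dvd q ^ g - 1" "c dvd q ^ h - 1"
    unfolding g_def h_def using bc q
    by (metis gcd_power_minus_one_nat gcd_greatest dvd_triv_left dvd_triv_right less_imp_le_nat
        less_le_trans zero_less_one)+
  moreover have gh0: "g > 0" "h > 0"
    using k by (auto simp: g_def h_def)
  moreover have "q ^ g > 1" "q ^ h > 1"
    using q gh0 by (simp_all only: one_less_power)
  ultimately have "b \<le> q ^ g - 1" "c \<le> q ^ h - 1"
    by (auto intro: dvd_imp_le)
  then have le: "q ^ k - 1 \<le> (q ^ g - 1) * (q ^ h - 1)"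
    using bc(1) mult_le_mono by metis
  have half: "2 * d \<le> k" if d: "d dvd k" "d \<noteq> k" for d
  proof -
    obtain e where "k = d * e" using d by auto
    moreover from this have "e \<ge> 2" using d k by (cases e; cases "e - 1") auto
    ultimately show ?thesis by simp
  qed
  have gk: "g \<noteq> k" "h \<noteq> k"
    using neg by (metis g_def gcd_dvd2, metis h_def gcd_dvd2)
  have "2 * g \<le> k" "2 * h \<le> k"
    using half gk by (auto simp: g_def h_def)
  \<comment> \<open>Proper divisors of \<open>k\<close> are at most \<open>k / 2\<close>, so
    \<open>g + h = k\<close> would force both to equal \<open>k / 2\<close>. As a common divisor of
    \<open>v\<close> and \<open>v - 1\<close> this is 1, giving the excluded value
    \<open>k = 2\<close>.\<close>
  moreover have "g \<noteq> h \<or> 2 * g \<noteq> k"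
  proof (rule ccontr)
    assume "\<not> ?thesis"
    then have "g dvd v" "g dvd v - 1" "2 * g = k"
      by (auto simp: g_def h_def) (metis gcd_dvd2)
    then have "g dvd 1"
      using v by (metis dvd_diff_nat diff_diff_cancel)
    then show False
      using \<open>2 * g = k\<close> \<open>k \<noteq> 2\<close> by simp
  qed
  ultimately have "g + h \<le> k - 1" "k \<ge> 1"
    by auto
  then have "q ^ (g + h) \<le> q ^ (k - 1)"
    using q by (intro power_increasing) auto
  moreover have "q ^ (k - 1) < q ^ k"
    using q k by (intro power_strict_increasing) auto
  \<comment> \<open>Strictness here makes up for the \<open>- 1\<close> in \<open>le\<close>: the
    chain yields \<open>q ^ k - 1 < q ^ (k - 1)\<close>, that is,
    \<open>q ^ k \<le> q ^ (k - 1)\<close>.\<close>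
  moreover have "(q ^ g - 1) * (q ^ h - 1) < q ^ g * q ^ h"
    using q by (intro mult_strict_mono) auto
  ultimately show False
    using le by (simp add: power_add)
qed

section \<open>Sizes of subspaces over a finite field\<close>

lemma card_span_independent:
  fixes B :: "('a :: {field, finite} ^ 'n :: finite) set"
  assumes "vec.independent B"
  shows "card (vec.span B) = CARD('a) ^ card B"
proof -
  have "finite B" by simp
  then show ?thesis using assms
  proof (induction B rule: finite_induct)
    case (insert a B)
    have a: "a \<notin> vec.span B" and B: "vec.independent B"
      using insert.prems insert.hyps by (auto simp: vec.independent_insert)
    \<comment> \<open>This map is a bijection onto the larger span, so a new independent vector
      multiplies the size by the number of scalars.\<close>
    let ?f = "\<lambda>(c, x). c *s a + x"
    have "inj_on ?f (UNIV \<times> vec.span B)"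
    proof (rule inj_onI, clarify)
      fix c x d y
      assume x: "x \<in> vec.span B" and y: "y \<in> vec.span B" and eq: "c *s a + x = d *s a + y"
      have "(c - d) *s a = y - x"
        using eq by (simp add: vec.scale_left_diff_distrib algebra_simps)
      then have "(c - d) *s a \<in> vec.span B"
        using x y by (simp add: vec.span_diff)
      then have "inverse (c - d) *s ((c - d) *s a) \<in> vec.span B"
        by (rule vec.span_scale)
      then have "c = d"
        using a by (cases "c = d") (simp_all only: vec.scale_scale, simp)
      then show "c = d \<and> x = y" using eq by simp
    qed
    moreover have "?f ` (UNIV \<times> vec.span B) = vec.span (insert a B)"
    proof (intro equalityI subsetI)
      fix x assume "x \<in> vec.span (insert a B)"
      then obtain c where "x - c *s a \<in> vec.span B"
        by (auto simp: vec.span_insert)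
      then show "x \<in> ?f ` (UNIV \<times> vec.span B)"
        by (intro image_eqI[where x = "(c, x - c *s a)"]) auto
    next
      fix x assume "x \<in> ?f ` (UNIV \<times> vec.span B)"
      then obtain c y where "x = c *s a + y" "y \<in> vec.span B"
        by auto
      then have "x - c *s a \<in> vec.span B"
        by simp
      then show "x \<in> vec.span (insert a B)"
        by (auto simp: vec.span_insert)
    qed
    ultimately have "card (vec.span (insert a B)) = card ((UNIV :: 'a set) \<times> vec.span B)"
      by (metis card_image)
    then show ?case
      using insert B by (simp add: card_cartesian_product)
  qed simp
qed

lemma card_subspace:
  fixes W :: "('a :: {field, finite} ^ 'n :: finite) set"
  assumes "vec.subspace W"
  shows "card W = CARD('a) ^ vec.dim W"
proof -
  obtain B where "B \<subseteq> W" "vec.independent B" "W \<subseteq> vec.span B" "card B = vec.dim W"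
    using vec.basis_exists by blast
  then show ?thesis
    using assms card_span_independent vec.span_minimal by (metis subset_antisym)
qed

section \<open>Counting points and blocks of a design\<close>

lemma card_blocks_through_point:
  fixes S :: "('a :: {field, finite} ^ 'n :: finite) set set"
  assumes S: "steiner_2_design q v k S" and k: "k \<ge> 2" and x: "x \<noteq> 0"
  shows "card {B \<in> S. x \<in> B} * (q ^ (k - 1) - 1) = q ^ (v - 1) - 1"
proof -
  let ?L = "vec.span {x}" and ?R = "{B \<in> S. x \<in> B}"
  have q: "CARD('a) = q" and v: "CARD('n) = v"
    and sub: "\<And>B. B \<in> S \<Longrightarrow> vec.subspace B" and dimB: "\<And>B. B \<in> S \<Longrightarrow> vec.dim B = k"
    and ex1: "\<And>T. vec.subspace T \<Longrightarrow> vec.dim T = 2 \<Longrightarrow> \<exists>!B. B \<in> S \<and> T \<subseteq> B"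
    using S by (auto simp: steiner_2_design_def)
  have q0: "q > 0" and v0: "v > 0"
    using q v by (auto simp flip: q v)
  have L: "card ?L = q"
    using card_span_independent[of "{x}"] x q by simp
  have L_sub: "?L \<subseteq> B" if "B \<in> ?R" for B
    using that sub by (intro vec.span_minimal) auto
  \<comment> \<open>A vector off the line spans a plane together with \<open>x\<close>, and a block
    contains that plane iff it contains both vectors.\<close>
  have ex1y: "\<exists>!B. B \<in> S \<and> x \<in> B \<and> y \<in> B" if "y \<notin> ?L" for y
  proof -
    have "vec.independent {y, x}"
      using that x by (simp add: vec.independent_insert)
    moreover have "y \<noteq> x" using that vec.span_base by blast
    ultimately have "vec.dim (vec.span {y, x}) = 2"
      using vec.dim_span_eq_card_independent[of "{y, x}"] by simp
    then have "\<exists>!B. B \<in> S \<and> vec.span {y, x} \<subseteq> B"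
      by (intro ex1) auto
    moreover have "vec.span {y, x} \<subseteq> B \<longleftrightarrow> x \<in> B \<and> y \<in> B" if "B \<in> S" for B
      using sub[OF that] vec.span_minimal[of "{y, x}" B] vec.span_superset[of "{y, x}"] by blast
    ultimately show ?thesis by (metis (no_types, lifting))
  qed
  \<comment> \<open>The blocks through \<open>x\<close> partition the vectors off the line, each
    contributing \<open>q ^ k - q\<close> of them.\<close>
  have "UNIV - ?L = (\<Union>B\<in>?R. B - ?L)"
  proof (intro equalityI subsetI)
    fix y assume "y \<in> UNIV - ?L"
    then show "y \<in> (\<Union>B\<in>?R. B - ?L)"
      using ex1y[of y] by auto
  qed simp
  also have "card \<dots> = (\<Sum>B\<in>?R. card (B - ?L))"
  proof (intro card_UN_disjoint ballI impI)
    fix B C assume *: "B \<in> ?R" "C \<in> ?R" "B \<noteq> C"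
    have False if "y \<in> B" "y \<in> C" "y \<notin> ?L" for y
      using ex1y[OF that(3)] that(1,2) * by auto
    then show "(B - ?L) \<inter> (C - ?L) = {}"
      by blast
  qed simp_all
  also have "\<dots> = (\<Sum>B\<in>?R. q ^ k - q)"
  proof (rule sum.cong)
    fix B assume "B \<in> ?R"
    then show "card (B - ?L) = q ^ k - q"
      using L_sub[of B] card_subspace[of B] sub dimB q L by (simp add: card_Diff_subset)
  qed simp
  finally have "q ^ v - q = card ?R * (q ^ k - q)"
    using L q v by (simp add: card_Diff_subset)
  moreover have "q ^ v - q = q * (q ^ (v - 1) - 1)" "q ^ k - q = q * (q ^ (k - 1) - 1)"
    using v0 k by (simp_all add: algebra_simps flip: power_Suc)
  ultimately show ?thesis
    using q0 by simp
qed

text \<open>Double counting of pairs of a nonzero vector and a block containing it. The extra factor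
  \<open>q ^ (k - 1) - 1\<close> lets the count of blocks through a point be substituted without
  division.\<close>

lemma card_blocks:
  fixes S :: "('a :: {field, finite} ^ 'n :: finite) set set"
  assumes S: "steiner_2_design q v k S" and k: "k \<ge> 2"
  shows "card S * (q ^ k - 1) * (q ^ (k - 1) - 1) = (q ^ v - 1) * (q ^ (v - 1) - 1)"
proof -
  have q: "CARD('a) = q" and v: "CARD('n) = v"
    and sub: "\<And>B. B \<in> S \<Longrightarrow> vec.subspace B" and dimB: "\<And>B. B \<in> S \<Longrightarrow> vec.dim B = k"
    using S by (auto simp: steiner_2_design_def)
  have "card (B - {0}) = q ^ k - 1" if "B \<in> S" for B
    using card_subspace[of B] sub[OF that] dimB[OF that] vec.subspace_0[of B] q by simp
  then have "card S * (q ^ k - 1) = (\<Sum>B\<in>S. card (B - {0}))"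
    by simp
  also have "\<dots> = (\<Sum>B\<in>S. \<Sum>x\<in>UNIV - {0}. if x \<in> B then 1 else 0)"
    by (intro sum.cong refl) (simp flip: sum.inter_filter, rule arg_cong[where f = card], auto)
  also have "\<dots> = (\<Sum>x\<in>UNIV - {0}. \<Sum>B\<in>S. if x \<in> B then 1 else 0)"
    by (rule sum.swap)
  also have "\<dots> = (\<Sum>x\<in>UNIV - {0}. card {B \<in> S. x \<in> B})"
    by (intro sum.cong refl) (simp flip: sum.inter_filter)
  finally have "card S * (q ^ k - 1) * (q ^ (k - 1) - 1)
      = (\<Sum>x\<in>UNIV - {0 :: 'a ^ 'n}. card {B \<in> S. x \<in> B} * (q ^ (k - 1) - 1))"
    by (simp add: sum_distrib_right)
  also have "\<dots> = (\<Sum>x\<in>UNIV - {0 :: 'a ^ 'n}. q ^ (v - 1) - 1)"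
    using card_blocks_through_point[OF S k] by (intro sum.cong) auto
  also have "\<dots> = (q ^ v - 1) * (q ^ (v - 1) - 1)"
    using q v by simp
  finally show ?thesis .
qed

theorem theorem6p1:
  fixes q v k :: nat
  assumes "primepow q"
    and "k \<ge> 2"
    and "\<exists>S :: ('a :: {field, finite} ^ 'n :: finite) set set. steiner_2_design q v k S"
  shows "[int v = 1] (mod (int k * (int k - 1))) \<or> [int v = int k] (mod (int k * (int k - 1)))"
proof -
  obtain S :: "('a ^ 'n) set set" where S: "steiner_2_design q v k S"
    using assms(3) by blast
  have q: "q > 1"
    using assms(1) primepow_gt_Suc_0 by simp
  have v: "v \<ge> 1"
    using S by (auto simp: steiner_2_design_def Suc_le_eq)
  have "q ^ (k - 1) - 1 dvd q ^ (v - 1) - 1"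
  proof -
    have "axis undefined 1 \<noteq> (0 :: 'a ^ 'n)"
      by simp
    from card_blocks_through_point[OF S assms(2) this] show ?thesis
      by (metis dvd_triv_right)
  qed
  then have "k - 1 dvd v - 1"
    using q by (rule dvd_of_power_minus_one_dvd[rotated])
  then have k1: "int k - 1 dvd int v - 1"
    using v assms(2) by (simp add: of_nat_diff flip: int_dvd_int_iff)
  have "q ^ k - 1 dvd (q ^ v - 1) * (q ^ (v - 1) - 1)"
    unfolding card_blocks[OF S assms(2), symmetric] by simp
  then have "k dvd v \<or> k dvd v - 1"
    using power_minus_one_dvd_prod_imp q assms(2) v by blast
  \<comment> \<open>Coprimality merges divisibility by \<open>k\<close> and by \<open>k - 1\<close>
    into divisibility by the full modulus.\<close>
  moreover have cop: "coprime (int k) (int k - 1)"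
    by (simp add: coprime_doff_one_right)
  ultimately show ?thesis
  proof (elim disjE)
    assume "k dvd v"
    then have "int k dvd int v - int k" by simp
    \<comment> \<open>Here \<open>v - k\<close> is the difference of \<open>v - 1\<close> and
      \<open>k - 1\<close>.\<close>
    moreover have "int k - 1 dvd int v - int k"
      using dvd_diff[OF k1 dvd_refl] by simp
    ultimately show ?thesis
      using cop by (simp add: cong_iff_dvd_diff divides_mult)
  next
    assume "k dvd v - 1"
    then have "int k dvd int v - 1"
      using v by (simp add: of_nat_diff flip: int_dvd_int_iff)
    then show ?thesis
      using cop k1 by (simp add: cong_iff_dvd_diff divides_mult)
  qed
qed

end
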